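(* Let $T$ be a rooted tree with two levels of descendants whose root has $n\geqslant 2$ children $a_1,\dotsc,a_n$, and for each $i\in\{1,\dotsc,n\}$ let $l_i\geqslant 0$ be the number of children of $a_i$. Let $l:=\left|\{i\in\{1,\dotsc,n\}: l_i=2\}\right|$. Then $T$ is not $d$-balanced if and only if $l=\frac{n-1}{2}$ and $l_i\in\{0,2\}$ for each $i\in\{1,\dotsc,n\}$.
   Context: For a simple undirected finite graph $G$ and $v\in V(G)$, the closed neighborhood is $N_G[v]=\{u\in V(G): uv\in E(G)\}\cup\{v\}$. A function $f\colon V(G)\to\{-1,0,1\}$ is a balanced domination function (BDF) on $G$ if $\sum_{u\in N_G[v]} f(u)=0$ for every $v\in V(G)$. Its weight is $\omega_f=\sum_{v\in V(G)} f(v)$. The balanced domination number $\gamma_{bd}(G)$ is the maximum of $\omega_f$ over all BDFs $f$ on $G$. The graph $G$ is called $d$-balanced if $\gamma_{bd}(G)=0$. A rooted tree $T$ with two levels of descendants has a root vertex $a_0$, whose children are $a_1,\dotsc,a_n$; each $a_i$ ($1\leqslant i\leqslant n$) has $l_i$ children, denoted $a_{i,1},\dotsc,a_{i,l_i}$ if $l_i\geqslant 1$; and the vertices $a_{i,j}$ have no children. The edges of $T$ are exactly the edges $a_0a_i$ and $a_ia_{i,j}$. *)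

theory Defs
  imports Complex_Main "Graph_Theory.Pair_Digraph"
begin

text \<open>
  A finite simple undirected graph is a \<^locale>\<open>pair_graph\<close>: every edge \<open>uv\<close> is
  represented by the two arcs \<open>(u, v)\<close> and \<open>(v, u)\<close>.
\<close>

definition closed_nbhd :: "'v pair_pre_digraph \<Rightarrow> 'v \<Rightarrow> 'v set" where
  "closed_nbhd G v = {u \<in> pverts G. (u, v) \<in> parcs G} \<union> {v}"

text \<open>
  Functions on the vertex set are total functions whose values outside \<open>pverts G\<close> are
  irrelevant.
\<close>

definition is_bdf :: "'v pair_pre_digraph \<Rightarrow> ('v \<Rightarrow> int) \<Rightarrow> bool" where
  "is_bdf G f \<longleftrightarrow>
     (\<forall>v \<in> pverts G. f v \<in> {-1, 0, 1}) \<and>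
     (\<forall>v \<in> pverts G. (\<Sum>u \<in> closed_nbhd G v. f u) = 0)"

definition weight :: "'v pair_pre_digraph \<Rightarrow> ('v \<Rightarrow> int) \<Rightarrow> int" where
  "weight G f = (\<Sum>v \<in> pverts G. f v)"

definition gamma_bd :: "'v pair_pre_digraph \<Rightarrow> int" where
  "gamma_bd G = Max {weight G f | f. is_bdf G f}"

definition d_balanced :: "'v pair_pre_digraph \<Rightarrow> bool" where
  "d_balanced G \<longleftrightarrow> gamma_bd G = 0"

text \<open>The maximum in \<^const>\<open>gamma_bd\<close> is taken over a finite nonempty set.\<close>

lemma bdf_weights_nonempty: "{weight G f | f. is_bdf G f} \<noteq> {}"
proof -
  have "is_bdf G (\<lambda>_. 0)"
    by (simp add: is_bdf_def)
  then show ?thesis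
    by blast
qed

lemma bdf_weights_finite: "finite {weight G f | f. is_bdf G f}"
proof (rule finite_subset)
  show "{weight G f | f. is_bdf G f} \<subseteq> {- int (card (pverts G)) .. int (card (pverts G))}"
  proof clarify
    fix f assume "is_bdf G f"
    then have *: "\<bar>f v\<bar> \<le> 1" if "v \<in> pverts G" for v
      using that by (auto simp: is_bdf_def)
    have "\<bar>weight G f\<bar> \<le> (\<Sum>v \<in> pverts G. \<bar>f v\<bar>)"
      unfolding weight_def by (rule sum_abs)
    also have "\<dots> \<le> int (card (pverts G))"
      using sum_bounded_above[of "pverts G" "\<lambda>v. \<bar>f v\<bar>" 1] * by simp
    finally show "weight G f \<in> {- int (card (pverts G)) .. int (card (pverts G))}"
      by auto
  qed
qed simp

text \<open>
  The vertices are the root \<open>r\<close>, its children \<open>a i\<close> for \<open>1 \<le> i \<le> n\<close>, and the children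
  \<open>b i j\<close> of \<open>a i\<close> for \<open>1 \<le> j \<le> l i\<close>; all of these are pairwise distinct.
  The values of \<open>l\<close>, \<open>a\<close> and \<open>b\<close> at other indices play no role.
\<close>

definition two_level_tree ::
    "'v pair_pre_digraph \<Rightarrow> nat \<Rightarrow> (nat \<Rightarrow> nat) \<Rightarrow> 'v \<Rightarrow> (nat \<Rightarrow> 'v) \<Rightarrow> (nat \<Rightarrow> nat \<Rightarrow> 'v) \<Rightarrow> bool"
  where
  "two_level_tree T n l r a b \<longleftrightarrow>
     (let A = a ` {1..n};
          B = {b i j | i j. i \<in> {1..n} \<and> j \<in> {1..l i}};
          E = {(r, a i) | i. i \<in> {1..n}} \<union> {(a i, b i j) | i j. i \<in> {1..n} \<and> j \<in> {1..l i}}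
      in inj_on a {1..n} \<and>
         inj_on (\<lambda>(i, j). b i j) (SIGMA i:{1..n}. {1..l i}) \<and>
         r \<notin> A \<and> r \<notin> B \<and> A \<inter> B = {} \<and>
         pverts T = {r} \<union> A \<union> B \<and>
         parcs T = E \<union> E\<inverse>)"

lemma two_level_tree_pair_graph:
  assumes "two_level_tree T n l r a b"
  shows "pair_graph T"
proof -
  define S where "S = (SIGMA i:{1..n}. {1..l i})"
  define B where "B = (\<lambda>(i, j). b i j) ` S"
  define E where "E = (\<lambda>i. (r, a i)) ` {1..n} \<union> (\<lambda>(i, j). (a i, b i j)) ` S"
  have eqB: "{b i j | i j. i \<in> {1..n} \<and> j \<in> {1..l i}} = B"
    by (auto simp: B_def S_def image_iff) blast
  have eqE: "{(r, a i) | i. i \<in> {1..n}} \<union> {(a i, b i j) | i j. i \<in> {1..n} \<and> j \<in> {1..l i}} = E"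
    unfolding E_def S_def by (rule set_eqI) (auto simp: image_iff Bex_def)
  have V: "pverts T = {r} \<union> a ` {1..n} \<union> B" and P: "parcs T = E \<union> E\<inverse>"
    and d: "r \<notin> a ` {1..n}" "a ` {1..n} \<inter> B = {}"
    using assms unfolding two_level_tree_def Let_def eqB eqE by blast+
  have fin: "finite (pverts T)" "finite (parcs T)"
    unfolding V P by (simp_all add: B_def E_def S_def)
  have E: "x \<in> pverts T \<and> y \<in> pverts T \<and> x \<noteq> y" if "(x, y) \<in> E" for x y
    using that d unfolding V E_def B_def S_def by force
  have "sym (parcs T)"
    unfolding P by (rule sym_Un_converse)
  then have sy: "symmetric (with_proj T)"
    by (simp add: symmetric_def)
  have arcs: "fst e \<in> pverts T \<and> snd e \<in> pverts T \<and> fst e \<noteq> snd e" if "e \<in> parcs T" for e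
    using that E[of "fst e" "snd e"] E[of "snd e" "fst e"] unfolding P by (cases e) auto
  show ?thesis
    by unfold_locales (use fin sy arcs in auto)
qed

lemma two_level_tree_exists:
  "\<exists>(T :: (nat \<times> nat) pair_pre_digraph) r a b. two_level_tree T n l r a b"
proof -
  let ?r = "(0, 0) :: nat \<times> nat" and ?a = "\<lambda>i. (i, 0) :: nat \<times> nat" and ?b = "\<lambda>i j :: nat. (i, j)"
  let ?E = "{(?r, ?a i) | i. i \<in> {1..n}} \<union> {(?a i, ?b i j) | i j. i \<in> {1..n} \<and> j \<in> {1..l i}}"
  let ?V = "{?r} \<union> ?a ` {1..n} \<union> {?b i j | i j. i \<in> {1..n} \<and> j \<in> {1..l i}}"
  have "two_level_tree \<lparr>pverts = ?V, parcs = ?E \<union> ?E\<inverse>\<rparr> n l ?r ?a ?b"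
    unfolding two_level_tree_def Let_def by (auto simp: inj_on_def)
  then show ?thesis
    by blast
qed

end

theory Submission
  imports Defs
begin

text \<open>
  At a leaf the balance condition forces \<open>f (b i j) = - f (a i)\<close>, so at \<open>a i\<close> it reads
  \<open>f r = (l i - 1) * f (a i)\<close>. Summing over \<open>i\<close> and using the condition at the root, the weight
  of \<open>f\<close> is \<open>- (n - 1) * f r\<close>. Hence a nonzero weight needs \<open>f r = \<plusminus>1\<close>, which forces
  \<open>l i \<in> {0, 2}\<close> and \<open>f (a i) = \<plusminus>f r\<close> accordingly; the condition at the root then counts the
  indices with \<open>l i = 2\<close>. Conversely these values, with \<open>f r = -1\<close>, define a function of positive
  weight.
\<close>

text \<open>If \<open>f\<close> is a BDF, then so is \<open>- f\<close>, with the opposite weight.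
  Hence a maximum of 0 bounds every weight from both sides. Conversely, the maximum is attained by
  some BDF, so it is 0 once all weights vanish.\<close>

lemma d_balanced_iff_weights:
  "d_balanced G \<longleftrightarrow> (\<forall>f. is_bdf G f \<longrightarrow> weight G f = 0)"
proof
  assume bal: "d_balanced G"
  have le: "weight G g \<le> 0" if "is_bdf G g" for g
    using Max_ge[OF bdf_weights_finite, of "weight G g" G] that bal
    by (auto simp: d_balanced_def gamma_bd_def)
  show "\<forall>f. is_bdf G f \<longrightarrow> weight G f = 0"
  proof (intro allI impI)
    fix f assume f: "is_bdf G f"
    have "is_bdf G (\<lambda>v. - f v)"
      using f by (auto simp: is_bdf_def sum_negf)
    from le[OF this] le[OF f] show "weight G f = 0"
      by (simp add: weight_def sum_negf)
  qed
next
  assume "\<forall>f. is_bdf G f \<longrightarrow> weight G f = 0"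
  then show "d_balanced G"
    using Max_in[OF bdf_weights_finite bdf_weights_nonempty, of G]
    by (auto simp: d_balanced_def gamma_bd_def)
qed

context
  fixes T :: "'v pair_pre_digraph"
    and n :: nat and l :: "nat \<Rightarrow> nat"
    and r :: 'v and a :: "nat \<Rightarrow> 'v" and b :: "nat \<Rightarrow> nat \<Rightarrow> 'v"
  assumes tree: "two_level_tree T n l r a b"
begin

lemmas tree_unfolded = tree[unfolded two_level_tree_def Let_def]

lemma inj_a: "inj_on a {1..n}"
  and inj_b: "inj_on (\<lambda>(i, j). b i j) (SIGMA i:{1..n}. {1..l i})"
  using tree_unfolded by simp_all

lemma pverts_tree:
  "pverts T = insert r (a ` {1..n} \<union> (\<lambda>(i, j). b i j) ` (SIGMA i:{1..n}. {1..l i}))"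
proof -
  have "{b i j | i j. i \<in> {1..n} \<and> j \<in> {1..l i}} = (\<lambda>(i, j). b i j) ` (SIGMA i:{1..n}. {1..l i})"
    by fast
  then show ?thesis
    using tree_unfolded by simp
qed

lemma a_eq_iff: "i \<in> {1..n} \<Longrightarrow> i' \<in> {1..n} \<Longrightarrow> a i = a i' \<longleftrightarrow> i = i'"
  using inj_a by (auto dest: inj_onD)

lemma b_eq_iff:
  assumes "i \<in> {1..n}" "j \<in> {1..l i}" "i' \<in> {1..n}" "j' \<in> {1..l i'}"
  shows "b i j = b i' j' \<longleftrightarrow> i = i' \<and> j = j'"
  using inj_onD[OF inj_b, of "(i, j)" "(i', j')"] assms by auto

lemma a_neq_r: "i \<in> {1..n} \<Longrightarrow> a i \<noteq> r"
  and b_neq_r: "i \<in> {1..n} \<Longrightarrow> j \<in> {1..l i} \<Longrightarrow> b i j \<noteq> r"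
  and a_neq_b: "i \<in> {1..n} \<Longrightarrow> i' \<in> {1..n} \<Longrightarrow> j \<in> {1..l i'} \<Longrightarrow> a i \<noteq> b i' j"
  using tree unfolding two_level_tree_def Let_def by blast+

lemmas distinct_vertices =
  a_eq_iff b_eq_iff a_neq_r b_neq_r a_neq_b a_neq_r[symmetric] b_neq_r[symmetric] a_neq_b[symmetric]

lemma parcs_tree:
  "(u, v) \<in> parcs T \<longleftrightarrow>
     (\<exists>i \<in> {1..n}. u = r \<and> v = a i \<or> u = a i \<and> v = r) \<or>
     (\<exists>i \<in> {1..n}. \<exists>j \<in> {1..l i}. u = a i \<and> v = b i j \<or> u = b i j \<and> v = a i)"
proof -
  have "parcs T = {(r, a i) | i. i \<in> {1..n}} \<union> {(a i, b i j) | i j. i \<in> {1..n} \<and> j \<in> {1..l i}} \<union>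
      ({(r, a i) | i. i \<in> {1..n}} \<union> {(a i, b i j) | i j. i \<in> {1..n} \<and> j \<in> {1..l i}})\<inverse>"
    using tree_unfolded by (elim conjE)
  then show ?thesis
    by blast
qed

lemma closed_nbhd_root: "closed_nbhd T r = insert r (a ` {1..n})"
  unfolding closed_nbhd_def parcs_tree pverts_tree
  by (auto simp del: atLeastAtMost_iff simp: distinct_vertices)

lemma closed_nbhd_child:
  assumes "i \<in> {1..n}"
  shows "closed_nbhd T (a i) = insert r (insert (a i) (b i ` {1..l i}))"
  using assms unfolding closed_nbhd_def parcs_tree pverts_tree
  by (auto simp del: atLeastAtMost_iff simp: distinct_vertices image_iff Bex_def)

lemma closed_nbhd_leaf:
  assumes "i \<in> {1..n}" "j \<in> {1..l i}"
  shows "closed_nbhd T (b i j) = {a i, b i j}"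
  using assms unfolding closed_nbhd_def parcs_tree pverts_tree
  by (auto simp del: atLeastAtMost_iff simp: distinct_vertices)

lemma sum_root: "(\<Sum>u\<in>closed_nbhd T r. f u) = f r + (\<Sum>i=1..n. f (a i))"
  for f :: "'v \<Rightarrow> int"
proof -
  have "r \<notin> a ` {1..n}"
    using a_neq_r by blast
  then show ?thesis
    by (simp add: closed_nbhd_root sum.reindex[OF inj_a] del: One_nat_def)
qed

lemma sum_child:
  fixes f :: "'v \<Rightarrow> int"
  assumes i: "i \<in> {1..n}"
  shows "(\<Sum>u\<in>closed_nbhd T (a i). f u) = f r + f (a i) + (\<Sum>j=1..l i. f (b i j))"
proof -
  have "r \<notin> insert (a i) (b i ` {1..l i})" "a i \<notin> b i ` {1..l i}"
    using i a_neq_r b_neq_r a_neq_b by blast+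
  moreover have "inj_on (b i) {1..l i}"
    using b_eq_iff i by (intro inj_onI) blast
  ultimately show ?thesis
    by (simp add: closed_nbhd_child[OF i] sum.reindex)
qed

lemma sum_leaf:
  fixes f :: "'v \<Rightarrow> int"
  assumes "i \<in> {1..n}" "j \<in> {1..l i}"
  shows "(\<Sum>u\<in>closed_nbhd T (b i j). f u) = f (a i) + f (b i j)"
  using a_neq_b[of i i j] assms by (simp add: closed_nbhd_leaf[OF assms])

text \<open>The three levels partition the vertices, and injectivity of \<open>b\<close> on pairs
  turns the sum over the last level into a double sum.\<close>

lemma weight_tree:
  "weight T f = f r + (\<Sum>i=1..n. f (a i)) + (\<Sum>i=1..n. \<Sum>j=1..l i. f (b i j))"
proof -
  let ?S = "SIGMA i:{1..n}. {1..l i}"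
  let ?B = "(\<lambda>(i, j). b i j) ` ?S"
  have "r \<notin> a ` {1..n} \<union> ?B" "a ` {1..n} \<inter> ?B = {}"
    using a_neq_r b_neq_r a_neq_b by fast+
  then have "weight T f = f r + ((\<Sum>i=1..n. f (a i)) + sum f ?B)"
    by (simp add: weight_def pverts_tree sum.union_disjoint sum.reindex[OF inj_a] del: One_nat_def)
  moreover have "sum f ?B = (\<Sum>i=1..n. \<Sum>j=1..l i. f (b i j))"
    unfolding sum.reindex[OF inj_b] by (simp add: sum.Sigma case_prod_unfold)
  ultimately show ?thesis
    by simp
qed

text \<open>The leaf equations give every leaf the value \<open>- f (a i)\<close>. This lies in {-1,
  0, 1} as soon as \<open>f (a i)\<close> does, so the range condition on leaves disappears, and the
  leaf sum at \<open>a i\<close> collapses to \<open>- int (l i) * f (a i)\<close>.\<close>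

lemma is_bdf_tree_iff:
  "is_bdf T f \<longleftrightarrow>
     f r \<in> {-1, 0, 1} \<and> f r + (\<Sum>i=1..n. f (a i)) = 0 \<and>
     (\<forall>i \<in> {1..n}. f (a i) \<in> {-1, 0, 1} \<and> f r = (int (l i) - 1) * f (a i) \<and>
        (\<forall>j \<in> {1..l i}. f (b i j) = - f (a i)))"
  (is "_ \<longleftrightarrow> ?R")
proof -
  have verts: "(\<forall>v \<in> pverts T. P v) \<longleftrightarrow>
      P r \<and> (\<forall>i \<in> {1..n}. P (a i) \<and> (\<forall>j \<in> {1..l i}. P (b i j)))" for P
    unfolding pverts_tree by (auto simp del: atLeastAtMost_iff)
  have leaves: "(\<Sum>j=1..l i. f (b i j)) = - int (l i) * f (a i)"
    if "\<forall>j \<in> {1..l i}. f (b i j) = - f (a i)" for i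
    using that by simp
  have child: "f (a i) \<in> {-1, 0, 1} \<and> (\<forall>j \<in> {1..l i}. f (b i j) \<in> {-1, 0, 1}) \<and>
      f r + f (a i) + (\<Sum>j=1..l i. f (b i j)) = 0 \<and> (\<forall>j \<in> {1..l i}. f (a i) + f (b i j) = 0) \<longleftrightarrow>
      f (a i) \<in> {-1, 0, 1} \<and> f r = (int (l i) - 1) * f (a i) \<and>
        (\<forall>j \<in> {1..l i}. f (b i j) = - f (a i))" for i
  \<comment> \<open>Both sides entail this condition, so if it fails, both are false.\<close>
  proof (cases "\<forall>j \<in> {1..l i}. f (b i j) = - f (a i)")
    case True
    then show ?thesis
      by (auto simp del: atLeastAtMost_iff simp: leaves[OF True] algebra_simps)
  next
    case False
    then show ?thesis
      by (metis add.inverse_unique)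
  qed
  have "is_bdf T f \<longleftrightarrow>
     f r \<in> {-1, 0, 1} \<and> f r + (\<Sum>i=1..n. f (a i)) = 0 \<and>
     (\<forall>i \<in> {1..n}. f (a i) \<in> {-1, 0, 1} \<and> (\<forall>j \<in> {1..l i}. f (b i j) \<in> {-1, 0, 1}) \<and>
        f r + f (a i) + (\<Sum>j=1..l i. f (b i j)) = 0 \<and> (\<forall>j \<in> {1..l i}. f (a i) + f (b i j) = 0))"
    unfolding is_bdf_def verts
    by (simp del: atLeastAtMost_iff insert_iff One_nat_def
        add: sum_root sum_child sum_leaf ball_conj_distrib conj_ac cong: ball_cong)
  then show ?thesis
    unfolding child .
qed

text \<open>The condition at \<open>a i\<close> makes its leaves sum to
  \<open>- f r - f (a i)\<close>. In the total weight the values \<open>f (a i)\<close> cancel,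
  leaving \<open>f r\<close> once and \<open>- f r\<close> for each of the \<open>n\<close>
  children.\<close>

lemma weight_bdf:
  assumes "is_bdf T f"
  shows "weight T f = - (int n - 1) * f r"
proof -
  note bdf = assms[unfolded is_bdf_tree_iff]
  have "(\<Sum>j=1..l i. f (b i j)) = - f r - f (a i)" if "i \<in> {1..n}" for i
    using bdf that by (simp del: atLeastAtMost_iff add: algebra_simps)
  then have "(\<Sum>i=1..n. \<Sum>j=1..l i. f (b i j)) = (\<Sum>i=1..n. - f r - f (a i))"
    by (rule sum.cong[OF refl])
  then have "weight T f = f r + (\<Sum>i=1..n. f (a i)) + (\<Sum>i=1..n. - f r - f (a i))"
    by (simp only: weight_tree)
  then have "weight T f = f r + (\<Sum>i=1..n. - f r)"
    by (simp add: sum_subtractf)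
  then show ?thesis
    by (simp add: algebra_simps)
qed

text \<open>This evaluates the sum over the root's children in both directions of the
  characterization below: with \<open>c = f r\<close> for a given BDF, and with
  \<open>c = -1\<close> for the constructed one.\<close>

lemma sum_signs:
  assumes "\<forall>i \<in> {1..n}. l i \<in> {0, 2}"
  shows "(\<Sum>i=1..n. if l i = 2 then c else - c) = (2 * int (card {i \<in> {1..n}. l i = 2}) - int n) * c"
proof -
  let ?L = "{i \<in> {1..n}. l i = 2}"
  \<comment> \<open>Writing each term as twice an indicator minus a constant makes the cardinality
    appear.\<close>
  have eq: "(if l i = 2 then c else - c) = 2 * (if l i = 2 then c else 0) - c" for i
    by simp
  have "(\<Sum>i=1..n. if l i = 2 then c else 0) = int (card ?L) * c"
    by (simp add: sum.If_cases Int_def)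
  then show ?thesis
    unfolding eq sum_subtractf sum_distrib_left[symmetric] by (simp add: algebra_simps)
qed

lemma bdf_root_nonzero_iff:
  "(\<exists>f. is_bdf T f \<and> f r \<noteq> 0) \<longleftrightarrow>
     2 * card {i \<in> {1..n}. l i = 2} + 1 = n \<and> (\<forall>i \<in> {1..n}. l i \<in> {0, 2})"
  (is "?L \<longleftrightarrow> ?R")
proof
  assume ?L
  then obtain f where f: "is_bdf T f" and nz: "f r \<noteq> 0"
    by blast
  note bdf = f[unfolded is_bdf_tree_iff]
  have child: "l i \<in> {0, 2} \<and> f (a i) = (if l i = 2 then f r else - f r)" if "i \<in> {1..n}" for i
  proof -
    \<comment> \<open>Here \<open>f r\<close> is 1 or -1, so both integer factors of the product are
      1 or -1. Thus \<open>int (l i) - 1\<close> is 1 or -1, and its sign relates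
      \<open>f (a i)\<close> to \<open>f r\<close>.\<close>
    have "f (a i) \<in> {-1, 0, 1}" "f r \<in> {-1, 0, 1}" "f r = (int (l i) - 1) * f (a i)"
      using bdf that by blast+
    then show ?thesis
      using nz by auto
  qed
  then have "(\<Sum>i=1..n. f (a i)) = (\<Sum>i=1..n. if l i = 2 then f r else - f r)"
    by (intro sum.cong) auto
  also have "\<dots> = (2 * int (card {i \<in> {1..n}. l i = 2}) - int n) * f r"
    using child by (intro sum_signs) blast
  \<comment> \<open>The summand 1 comes from \<open>f r\<close> itself in the root equation;
    cancelling \<open>f r\<close> then gives the count.\<close>
  finally have "(2 * int (card {i \<in> {1..n}. l i = 2}) + 1 - int n) * f r = 0"
    using bdf by (simp add: algebra_simps)
  with nz child show ?R
    by auto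
next
  assume R: ?R
  \<comment> \<open>These are the values forced by \<open>f r = -1\<close>: children with two leaves
    copy the root, childless ones take the opposite sign, and each leaf negates its parent, whose
    value is -1.\<close>
  define f where "f v = (if v = r \<or> (\<exists>i \<in> {1..n}. l i = 2 \<and> v = a i) then -1 else 1 :: int)" for v
  have fr: "f r = -1"
    by (simp add: f_def)
  have fa: "f (a i) = (if l i = 2 then -1 else 1)" if "i \<in> {1..n}" for i
    using that unfolding f_def by (metis a_eq_iff a_neq_r)
  have fb: "f (b i j) = 1" if "i \<in> {1..n}" "j \<in> {1..l i}" for i j
    using that unfolding f_def by (metis a_neq_b b_neq_r)
  \<comment> \<open>The value 1 is written as \<open>- (-1)\<close> to match
    \<open>sum_signs\<close> with \<open>c = -1\<close>.\<close>
  have "(\<Sum>i=1..n. f (a i)) = (\<Sum>i=1..n. if l i = 2 then -1 else - (-1))"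
    by (intro sum.cong) (simp_all del: atLeastAtMost_iff add: fa)
  also have "\<dots> = (2 * int (card {i \<in> {1..n}. l i = 2}) - int n) * -1"
    using R by (intro sum_signs) blast
  also have "int n = 2 * int (card {i \<in> {1..n}. l i = 2}) + 1"
    using R by linarith
  finally have "f r + (\<Sum>i=1..n. f (a i)) = 0"
    using fr by simp
  then have "is_bdf T f"
    unfolding is_bdf_tree_iff using R fr fa fb by fastforce
  with fr show ?L
    by auto
qed

end

theorem theorem4:
  fixes T :: "'v pair_pre_digraph"
    and n :: nat and l :: "nat \<Rightarrow> nat"
    and r :: 'v and a :: "nat \<Rightarrow> 'v" and b :: "nat \<Rightarrow> nat \<Rightarrow> 'v"
  assumes "two_level_tree T n l r a b"
    and "n \<ge> 2"
  shows "\<not> d_balanced T \<longleftrightarrow>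
           real (card {i \<in> {1..n}. l i = 2}) = (real n - 1) / 2 \<and>
           (\<forall>i \<in> {1..n}. l i \<in> {0, 2})"
proof -
  \<comment> \<open>Since \<open>n \<ge> 2\<close>, the factor \<open>int n - 1\<close> is nonzero,
    so the weight of a BDF vanishes exactly when its root value does.\<close>
  have "\<not> d_balanced T \<longleftrightarrow> (\<exists>f. is_bdf T f \<and> f r \<noteq> 0)"
    using weight_bdf[OF assms(1)] assms(2) by (auto simp: d_balanced_iff_weights)
  moreover have "2 * card {i \<in> {1..n}. l i = 2} + 1 = n \<longleftrightarrow>
      real (card {i \<in> {1..n}. l i = 2}) = (real n - 1) / 2"
    by (simp add: field_simps) linarith
  ultimately show ?thesis
    using bdf_root_nonzero_iff[OF assms(1)] by simp
qed

end
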